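(* Let $\Gamma=(V,\rho,a,B)$ be a finite network with edge parameters $R_{xy},L_{xy},D_{xy}$, and assume that $L_{xy}>0$ for all $xy\in E$. Set $$S_D=\sup_{xy\in E}\frac{D_{xy}}{L_{xy}},\quad S_D^{*}=\inf_{xy\in E}\frac{D_{xy}}{L_{xy}},\quad S_R=\sup_{xy\in E}\frac{R_{xy}}{L_{xy}},\quad C'=\sum_{x\sim a}\frac{1}{L_{xa}}.$$ Then, in the domain $$\Omega^{*}=\{\lambda\in\mathbb{C}:\operatorname{Im}\lambda\ne0\ \text{and}\ |\lambda|^{2}<S_D^{*}\},$$ the function $\mathcal{P}(\lambda)$ is holomorphic and $$|\mathcal{P}(\lambda)|\le\frac{C'\,(|\lambda|^{2}+S_R|\lambda|+S_D)^{2}\,|\lambda|^{4}}{(S_D^{*}-|\lambda|^{2})^{3}\,|\operatorname{Im}\lambda|^{3}}.$$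
   Context: Let $(V,E)$ be a finite connected undirected graph with $|V|\ge2$, edges being unordered pairs $xy$ of vertices; $x\sim y$ means $xy\in E$. Each edge $xy\in E$ carries real numbers $R_{xy},L_{xy},D_{xy}\in[0,+\infty)$ with $R_{xy}+L_{xy}+D_{xy}>0$. For $\lambda\in\mathbb{C}\setminus\{0\}$ put $z_{xy}^{(\lambda)}=R_{xy}+L_{xy}\lambda+\frac{D_{xy}}{\lambda}$ (impedance) and $\rho_{xy}^{(\lambda)}=1/z_{xy}^{(\lambda)}$ (admittance); set $\rho_{xy}^{(\lambda)}=0$ if $x\not\sim y$. Let $\Lambda$ be the set of those $\lambda\in\mathbb{C}\setminus\{0\}$ with $L_{xy}\lambda^2+R_{xy}\lambda+D_{xy}\ne0$ for all $xy\in E$. Fix $a\in V$ and a non-empty $B\subset V$ with $a\notin B$; put $B_0=B\cup\{a\}$. The structure $\Gamma=(V,\rho,a,B)$ is called a finite network. For $\lambda\in\Lambda$ and $f:V\to\mathbb{C}$ put $\Delta_\rho f(x)=\sum_{y\in V}(f(y)-f(x))\rho_{xy}^{(\lambda)}$. The Dirichlet problem for $v:V\to\mathbb{C}$ is: $\Delta_\rho v(x)=0$ for $x\in V\setminus B_0$, $v(x)=0$ for $x\in B$, $v(a)=1$. The effective admittance of $\Gamma$ is $\mathcal{P}(\lambda)=\sum_{x\in V}(1-v(x))\rho_{xa}^{(\lambda)}$ where $v$ is any solution of the Dirichlet problem (the value does not depend on the choice of the solution); if there is no solution, $\mathcal{P}(\lambda)=\infty$. *)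

theory Defs
  imports "HOL-Analysis.Analysis" "HOL-Library.Uprod"
begin

record 'v network =
  vertices :: "'v set"
  edges :: "'v uprod set"
  resistance :: "'v uprod \<Rightarrow> real"   (* R *)
  inductance :: "'v uprod \<Rightarrow> real"   (* L *)
  elastance :: "'v uprod \<Rightarrow> real"    (* D, the inverse capacitance *)
  source :: 'v                        (* a *)
  ground :: "'v set"                  (* B *)

definition adjacent :: "'v network \<Rightarrow> 'v \<Rightarrow> 'v \<Rightarrow> bool" where
  "adjacent \<Gamma> x y \<longleftrightarrow> Upair x y \<in> edges \<Gamma>"

(* Loops Upair x x are not excluded; simple graphs are a special case. *)
definition finite_network :: "'v network \<Rightarrow> bool" where
  "finite_network \<Gamma> \<longleftrightarrow>
     finite (vertices \<Gamma>) \<and> card (vertices \<Gamma>) \<ge> 2 \<and>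
     (\<forall>e\<in>edges \<Gamma>. set_uprod e \<subseteq> vertices \<Gamma>) \<and>
     (\<forall>x\<in>vertices \<Gamma>. \<forall>y\<in>vertices \<Gamma>. (adjacent \<Gamma>)\<^sup>*\<^sup>* x y) \<and>
     (\<forall>e\<in>edges \<Gamma>. resistance \<Gamma> e \<ge> 0 \<and> inductance \<Gamma> e \<ge> 0 \<and> elastance \<Gamma> e \<ge> 0 \<and>
        resistance \<Gamma> e + inductance \<Gamma> e + elastance \<Gamma> e > 0) \<and>
     source \<Gamma> \<in> vertices \<Gamma> \<and>
     ground \<Gamma> \<noteq> {} \<and> ground \<Gamma> \<subseteq> vertices \<Gamma> \<and> source \<Gamma> \<notin> ground \<Gamma>"

definition impedance :: "'v network \<Rightarrow> complex \<Rightarrow> 'v uprod \<Rightarrow> complex" where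
  "impedance \<Gamma> \<mu> e =
     of_real (resistance \<Gamma> e) + of_real (inductance \<Gamma> e) * \<mu> + of_real (elastance \<Gamma> e) / \<mu>"

definition admittance :: "'v network \<Rightarrow> complex \<Rightarrow> 'v \<Rightarrow> 'v \<Rightarrow> complex" where
  "admittance \<Gamma> \<mu> x y = (if adjacent \<Gamma> x y then 1 / impedance \<Gamma> \<mu> (Upair x y) else 0)"

(* The set Lambda on which all admittances, and hence the Dirichlet problem, are meaningful. *)
definition admissible :: "'v network \<Rightarrow> complex set" where
  "admissible \<Gamma> = {\<mu>. \<mu> \<noteq> 0 \<and>
     (\<forall>e\<in>edges \<Gamma>. of_real (inductance \<Gamma> e) * \<mu>\<^sup>2 + of_real (resistance \<Gamma> e) * \<mu>
        + of_real (elastance \<Gamma> e) \<noteq> 0)}"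

definition laplacian :: "'v network \<Rightarrow> complex \<Rightarrow> ('v \<Rightarrow> complex) \<Rightarrow> 'v \<Rightarrow> complex" where
  "laplacian \<Gamma> \<mu> f x = (\<Sum>y\<in>vertices \<Gamma>. (f y - f x) * admittance \<Gamma> \<mu> x y)"

definition dirichlet_solution :: "'v network \<Rightarrow> complex \<Rightarrow> ('v \<Rightarrow> complex) \<Rightarrow> bool" where
  "dirichlet_solution \<Gamma> \<mu> v \<longleftrightarrow>
     (\<forall>x \<in> vertices \<Gamma> - (ground \<Gamma> \<union> {source \<Gamma>}). laplacian \<Gamma> \<mu> v x = 0) \<and>
     (\<forall>x \<in> ground \<Gamma>. v x = 0) \<and> v (source \<Gamma>) = 1"

definition source_flow :: "'v network \<Rightarrow> complex \<Rightarrow> ('v \<Rightarrow> complex) \<Rightarrow> complex" where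
  "source_flow \<Gamma> \<mu> v = (\<Sum>x\<in>vertices \<Gamma>. (1 - v x) * admittance \<Gamma> \<mu> x (source \<Gamma>))"

(* The value None stands for infinity. The choice of the solution is immaterial, see
   effective_admittance_eq below. Meaningful only for \<mu> in admissible \<Gamma>. *)
definition effective_admittance :: "'v network \<Rightarrow> complex \<Rightarrow> complex option" where
  "effective_admittance \<Gamma> \<mu> =
     (if \<exists>v. dirichlet_solution \<Gamma> \<mu> v
      then Some (source_flow \<Gamma> \<mu> (SOME v. dirichlet_solution \<Gamma> \<mu> v))
      else None)"

lemma admittance_sym: "admittance \<Gamma> \<mu> x y = admittance \<Gamma> \<mu> y x"
proof -
  have "Upair x y = Upair y x" by simp
  then show ?thesis unfolding admittance_def adjacent_def by metis
qed

lemma green: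
  "(\<Sum>x\<in>vertices \<Gamma>. w x * laplacian \<Gamma> \<mu> v x) = (\<Sum>x\<in>vertices \<Gamma>. v x * laplacian \<Gamma> \<mu> w x)"
proof -
  let ?V = "vertices \<Gamma>" and ?r = "admittance \<Gamma> \<mu>"
  have expand: "(\<Sum>x\<in>?V. f x * laplacian \<Gamma> \<mu> g x) =
      (\<Sum>x\<in>?V. \<Sum>y\<in>?V. f x * g y * ?r x y) - (\<Sum>x\<in>?V. \<Sum>y\<in>?V. f x * g x * ?r x y)" for f g
    by (simp add: laplacian_def sum_distrib_left algebra_simps sum_subtractf)
  have "(\<Sum>x\<in>?V. \<Sum>y\<in>?V. w x * v y * ?r x y) = (\<Sum>y\<in>?V. \<Sum>x\<in>?V. w x * v y * ?r x y)"
    by (rule sum.swap)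
  also have "\<dots> = (\<Sum>x\<in>?V. \<Sum>y\<in>?V. v x * w y * ?r x y)"
    by (intro sum.cong refl) (simp add: admittance_sym mult.commute)
  finally show ?thesis by (simp add: expand mult.commute)
qed

lemma source_flow_unique:
  assumes net: "finite_network \<Gamma>"
    and v: "dirichlet_solution \<Gamma> \<mu> v" and w: "dirichlet_solution \<Gamma> \<mu> w"
  shows "source_flow \<Gamma> \<mu> v = source_flow \<Gamma> \<mu> w"
proof -
  let ?a = "source \<Gamma>"
  have fin: "finite (vertices \<Gamma>)" and a: "?a \<in> vertices \<Gamma>"
    using net by (auto simp: finite_network_def)
  have flow: "source_flow \<Gamma> \<mu> u = - laplacian \<Gamma> \<mu> u ?a" if "dirichlet_solution \<Gamma> \<mu> u" for u
  proof -
    have "u ?a = 1" using that by (simp add: dirichlet_solution_def)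
    then show ?thesis
      unfolding source_flow_def laplacian_def
      by (simp add: sum_negf[symmetric] admittance_sym[of _ _ ?a])
        (simp add: algebra_simps)
  qed
  have pair: "(\<Sum>x\<in>vertices \<Gamma>. p x * laplacian \<Gamma> \<mu> q x) = laplacian \<Gamma> \<mu> q ?a"
    if p: "dirichlet_solution \<Gamma> \<mu> p" and q: "dirichlet_solution \<Gamma> \<mu> q" for p q
  proof -
    have "(\<Sum>x\<in>vertices \<Gamma>. p x * laplacian \<Gamma> \<mu> q x) =
        (\<Sum>x\<in>{?a}. p x * laplacian \<Gamma> \<mu> q x)"
      using p q fin a by (intro sum.mono_neutral_right) (auto simp: dirichlet_solution_def)
    then show ?thesis using p by (simp add: dirichlet_solution_def)
  qed
  show ?thesis
    using green[where w = w and v = v and \<Gamma> = \<Gamma> and \<mu> = \<mu>] by (simp add: flow v w pair)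
qed

lemma effective_admittance_eq:
  assumes "finite_network \<Gamma>" and "dirichlet_solution \<Gamma> \<mu> v"
  shows "effective_admittance \<Gamma> \<mu> = Some (source_flow \<Gamma> \<mu> v)"
  using assms source_flow_unique someI[of "dirichlet_solution \<Gamma> \<mu>" v]
  unfolding effective_admittance_def by auto

end

theory Submission
  imports Defs
begin

text \<open>
  Write \<open>m = |\<mu>|\<close>, let \<open>S\<close> be the infimum of \<open>D/L\<close>, and let \<open>\<rho>\<close> be the admittances. The imaginary
  part of the impedance of an edge is \<open>Im \<mu> (L - D/m\<^sup>2)\<close>, so where \<open>m\<^sup>2 < S\<close> every \<open>Im \<rho>\<close> has the
  strict sign of \<open>Im \<mu>\<close>: the numbers \<open>\<kappa> = Im \<rho> / Im \<mu>\<close> are positive edge weights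
  (\<open>Im_admittance\<close>).

  Summation by parts turns \<open>\<Sum>x. cnj (f x) \<Delta>f(x)\<close> into minus the sum of \<open>|f x - f y|\<^sup>2 \<rho>\<close> over the
  edges (\<open>sum_cnj_laplacian\<close>). Its imaginary part, divided by \<open>Im \<mu>\<close>, is minus the ordinary Dirichlet
  energy with weights \<open>\<kappa>\<close>, which on a connected graph vanishes only for constants. Hence the linear
  system of the Dirichlet problem has an anisotropic sesquilinear form. Gaussian elimination on such a
  system meets only nonzero pivots, so it solves the system for all \<open>\<mu>\<close> at once by rational operations
  in the entries, and the solution is holomorphic in \<open>\<mu>\<close>
  (\<open>holomorphic_solution_of_anisotropic_system\<close>, \<open>holomorphic_dirichlet_solution\<close>).

  For the bound, the solution \<open>v\<close> has Dirichlet energy \<open>Im P / Im \<mu> \<le> |P| / |Im \<mu>|\<close>, while \<open>P\<close> itself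
  is the flow \<open>\<Sum>x. (1 - v x) \<rho>(x,a)\<close> out of the source. Since
  \<open>|\<rho>|\<^sup>2 = \<kappa> m\<^sup>2 / (D - L m\<^sup>2) \<le> \<kappa> m\<^sup>2 / (L (S - m\<^sup>2))\<close>, Cauchy-Schwarz gives
  \<open>|P|\<^sup>2 \<le> |P| / |Im \<mu>| \<cdot> C' m\<^sup>2 / (S - m\<^sup>2)\<close> (\<open>norm_source_flow_le\<close>). Cancelling \<open>|P|\<close> leaves
  \<open>|P| \<le> C' m\<^sup>2 / ((S - m\<^sup>2) |Im \<mu>|)\<close>. The bound of the theorem is this one multiplied by
  the square of \<open>(m\<^sup>2 + S\<^sub>R m + S\<^sub>D) m / ((S - m\<^sup>2) |Im \<mu>|)\<close>, a number that is at least 1.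
\<close>

section \<open>Linear systems with holomorphic coefficients\<close>

text \<open>
  Solvability alone would follow from the absence of a kernel. The stronger hypothesis that the form
  \<open>\<Sum>x y. cnj (f x) M x y (f y)\<close> has no nontrivial zero makes elimination work without choosing pivots:
  evaluated at a unit vector it says that the diagonal entries are nonzero, and it passes to
  the Schur complement, because back substitution extends a vector on the smaller index set without
  changing the value of the form.
\<close>
lemma holomorphic_solution_of_anisotropic_system:
  fixes M :: "complex \<Rightarrow> 'v \<Rightarrow> 'v \<Rightarrow> complex" and b :: "complex \<Rightarrow> 'v \<Rightarrow> complex"
  assumes "finite I"
    and "\<And>x y. x \<in> I \<Longrightarrow> y \<in> I \<Longrightarrow> (\<lambda>\<mu>. M \<mu> x y) holomorphic_on \<Omega>"
    and "\<And>x. x \<in> I \<Longrightarrow> (\<lambda>\<mu>. b \<mu> x) holomorphic_on \<Omega>"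
    and "\<And>\<mu> f. \<mu> \<in> \<Omega> \<Longrightarrow> (\<Sum>x\<in>I. cnj (f x) * (\<Sum>y\<in>I. M \<mu> x y * f y)) = 0 \<Longrightarrow> \<forall>x\<in>I. f x = 0"
  shows "\<exists>u. (\<forall>x\<in>I. (\<lambda>\<mu>. u \<mu> x) holomorphic_on \<Omega>) \<and>
    (\<forall>\<mu>\<in>\<Omega>. \<forall>x\<in>I. (\<Sum>y\<in>I. M \<mu> x y * u \<mu> y) = b \<mu> x)"
  using assms
proof (induction I arbitrary: M b rule: finite_induct)
  case empty
  then show ?case by simp
next
  case (insert k I)
  note hol = insert.prems(1) and bhol = insert.prems(2) and aniso = insert.prems(3)
  have pivot: "M \<mu> k k \<noteq> 0" if "\<mu> \<in> \<Omega>" for \<mu>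
  proof
    assume "M \<mu> k k = 0"
    let ?f = "\<lambda>x. if x = k then 1 else (0::complex)"
    have zero: "(\<Sum>x\<in>I. cnj (?f x) * g x) = 0" for g
      using insert.hyps by (intro sum.neutral) auto
    have zero': "(\<Sum>y\<in>I. M \<mu> k y * ?f y) = 0"
      using insert.hyps by (intro sum.neutral) auto
    have "(\<Sum>x\<in>insert k I. cnj (?f x) * (\<Sum>y\<in>insert k I. M \<mu> x y * ?f y)) = 0"
      using insert.hyps zero zero' \<open>M \<mu> k k = 0\<close> by simp
    from aniso[OF that this] show False by simp
  qed
  \<comment> \<open>Schur complement of the pivot, the reduced right-hand side, and back substitution:
    the value at \<open>k\<close> is chosen so that row \<open>k\<close> yields \<open>t\<close>.\<close>
  define S where "S \<mu> x y = M \<mu> x y - M \<mu> x k * M \<mu> k y / M \<mu> k k" for \<mu> x y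
  define c where "c \<mu> x = b \<mu> x - M \<mu> x k * b \<mu> k / M \<mu> k k" for \<mu> x
  define backsub where "backsub \<mu> t f = f(k := (t - (\<Sum>y\<in>I. M \<mu> k y * f y)) / M \<mu> k k)"
    for \<mu> t and f :: "'v \<Rightarrow> complex"
  have backsub_I: "backsub \<mu> t f x = f x" if "x \<in> I" for \<mu> t f x
    using that insert.hyps by (auto simp: backsub_def)
  have backsub_k: "backsub \<mu> t f k = (t - (\<Sum>y\<in>I. M \<mu> k y * f y)) / M \<mu> k k" for \<mu> t f
    by (simp add: backsub_def)
  have row_k: "(\<Sum>y\<in>insert k I. M \<mu> k y * backsub \<mu> t f y) = t" if "\<mu> \<in> \<Omega>" for \<mu> t f
  proof -
    have "(\<Sum>y\<in>insert k I. M \<mu> k y * backsub \<mu> t f y)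
        = M \<mu> k k * backsub \<mu> t f k + (\<Sum>y\<in>I. M \<mu> k y * f y)"
      using insert.hyps by (simp add: backsub_I)
    then show ?thesis using pivot[OF that] by (simp add: backsub_k)
  qed
  have row_I: "(\<Sum>y\<in>insert k I. M \<mu> x y * backsub \<mu> t f y)
      = (\<Sum>y\<in>I. S \<mu> x y * f y) + M \<mu> x k * t / M \<mu> k k" if "\<mu> \<in> \<Omega>" for \<mu> t f x
  proof -
    have "(\<Sum>y\<in>insert k I. M \<mu> x y * backsub \<mu> t f y)
        = M \<mu> x k * backsub \<mu> t f k + (\<Sum>y\<in>I. M \<mu> x y * f y)"
      using insert.hyps by (simp add: backsub_I)
    moreover have "(\<Sum>y\<in>I. S \<mu> x y * f y)
        = (\<Sum>y\<in>I. M \<mu> x y * f y) - M \<mu> x k / M \<mu> k k * (\<Sum>y\<in>I. M \<mu> k y * f y)"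
      by (simp add: S_def algebra_simps sum_subtractf sum_distrib_left)
    ultimately show ?thesis
      by (simp add: backsub_k right_diff_distrib diff_divide_distrib)
  qed
  have "\<exists>u. (\<forall>x\<in>I. (\<lambda>\<mu>. u \<mu> x) holomorphic_on \<Omega>) \<and>
    (\<forall>\<mu>\<in>\<Omega>. \<forall>x\<in>I. (\<Sum>y\<in>I. S \<mu> x y * u \<mu> y) = c \<mu> x)"
  proof (rule insert.IH)
    show "(\<lambda>\<mu>. S \<mu> x y) holomorphic_on \<Omega>" if "x \<in> I" "y \<in> I" for x y
      unfolding S_def using that pivot by (intro holomorphic_intros hol) auto
    show "(\<lambda>\<mu>. c \<mu> x) holomorphic_on \<Omega>" if "x \<in> I" for x
      unfolding c_def using that pivot by (intro holomorphic_intros hol bhol) auto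
    show "\<forall>x\<in>I. f x = 0"
      if \<mu>: "\<mu> \<in> \<Omega>" and f: "(\<Sum>x\<in>I. cnj (f x) * (\<Sum>y\<in>I. S \<mu> x y * f y)) = 0" for \<mu> f
    proof -
      let ?g = "backsub \<mu> 0 f"
      have "(\<Sum>x\<in>insert k I. cnj (?g x) * (\<Sum>y\<in>insert k I. M \<mu> x y * ?g y))
          = cnj (?g k) * (\<Sum>y\<in>insert k I. M \<mu> k y * ?g y)
            + (\<Sum>x\<in>I. cnj (?g x) * (\<Sum>y\<in>insert k I. M \<mu> x y * ?g y))"
        by (rule sum.insert[OF insert.hyps])
      also have "\<dots> = (\<Sum>x\<in>I. cnj (f x) * (\<Sum>y\<in>I. S \<mu> x y * f y))"
        unfolding row_k[OF \<mu>] unfolding row_I[OF \<mu>] by (simp add: backsub_I)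
      finally have "(\<Sum>x\<in>insert k I. cnj (?g x) * (\<Sum>y\<in>insert k I. M \<mu> x y * ?g y))
          = (\<Sum>x\<in>I. cnj (f x) * (\<Sum>y\<in>I. S \<mu> x y * f y))" .
      with aniso[OF \<mu>] f have "\<forall>x\<in>insert k I. ?g x = 0" by simp
      then show ?thesis by (auto simp: backsub_I)
    qed
  qed
  then obtain u where uhol: "\<And>x. x \<in> I \<Longrightarrow> (\<lambda>\<mu>. u \<mu> x) holomorphic_on \<Omega>"
    and u: "\<And>\<mu> x. \<mu> \<in> \<Omega> \<Longrightarrow> x \<in> I \<Longrightarrow> (\<Sum>y\<in>I. S \<mu> x y * u \<mu> y) = c \<mu> x"
    by blast
  let ?u = "\<lambda>\<mu>. backsub \<mu> (b \<mu> k) (u \<mu>)"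
  have u_hol: "(\<lambda>\<mu>. ?u \<mu> x) holomorphic_on \<Omega>" if "x \<in> insert k I" for x
  proof (cases "x = k")
    case True
    have "(\<lambda>\<mu>. (b \<mu> k - (\<Sum>y\<in>I. M \<mu> k y * u \<mu> y)) / M \<mu> k k) holomorphic_on \<Omega>"
      using pivot by (intro holomorphic_intros hol bhol uhol) auto
    then show ?thesis using True by (simp add: backsub_def)
  next
    case False
    then show ?thesis using that uhol by (simp add: backsub_I)
  qed
  have u_sol: "(\<Sum>y\<in>insert k I. M \<mu> x y * ?u \<mu> y) = b \<mu> x"
    if "\<mu> \<in> \<Omega>" "x \<in> insert k I" for \<mu> x
  proof (cases "x = k")
    case True
    then show ?thesis using row_k that by blast
  next
    case False
    then have "x \<in> I" using that by blast
    then show ?thesis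
      unfolding row_I[OF that(1)] by (simp add: u that(1) c_def)
  qed
  show ?case
    by (intro exI[of _ ?u] conjI ballI u_hol u_sol)
qed

section \<open>The energy of a potential\<close>

text \<open>
  The symmetry of the admittances lets each term be averaged with the one in which the two end points
  are exchanged. The factor 1/2 remains because every edge is counted in both directions.
\<close>
lemma sum_cnj_laplacian:
  "(\<Sum>x\<in>vertices \<Gamma>. cnj (f x) * laplacian \<Gamma> \<mu> f x) =
    - (\<Sum>x\<in>vertices \<Gamma>. \<Sum>y\<in>vertices \<Gamma>. of_real ((cmod (f x - f y))\<^sup>2) * admittance \<Gamma> \<mu> x y) / 2"
proof -
  let ?V = "vertices \<Gamma>" and ?r = "admittance \<Gamma> \<mu>"
  let ?T = "\<Sum>x\<in>?V. \<Sum>y\<in>?V. cnj (f x) * (f y - f x) * ?r x y"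
  have T: "(\<Sum>x\<in>?V. cnj (f x) * laplacian \<Gamma> \<mu> f x) = ?T"
    by (simp add: laplacian_def sum_distrib_left mult.assoc)
  have "?T = (\<Sum>y\<in>?V. \<Sum>x\<in>?V. cnj (f x) * (f y - f x) * ?r x y)"
    by (rule sum.swap)
  also have "\<dots> = (\<Sum>x\<in>?V. \<Sum>y\<in>?V. cnj (f y) * (f x - f y) * ?r x y)"
    by (simp add: admittance_sym)
  finally have "?T + ?T = (\<Sum>x\<in>?V. \<Sum>y\<in>?V. cnj (f x) * (f y - f x) * ?r x y
      + cnj (f y) * (f x - f y) * ?r x y)"
    by (simp add: sum.distrib)
  also have "\<dots> = (\<Sum>x\<in>?V. \<Sum>y\<in>?V. - (of_real ((cmod (f x - f y))\<^sup>2) * ?r x y))"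
    unfolding complex_norm_square by (intro sum.cong refl) (simp add: algebra_simps)
  finally have "?T + ?T = - (\<Sum>x\<in>?V. \<Sum>y\<in>?V. of_real ((cmod (f x - f y))\<^sup>2) * ?r x y)"
    by (simp add: sum_negf)
  moreover have "t = - e / 2" if "t + t = - e" for t e :: complex
    using that by (simp add: field_simps)
  ultimately show ?thesis unfolding T by blast
qed

lemma source_flow_eq_laplacian:
  assumes "v (source \<Gamma>) = 1"
  shows "source_flow \<Gamma> \<mu> v = - laplacian \<Gamma> \<mu> v (source \<Gamma>)"
  unfolding source_flow_def laplacian_def
  by (simp add: assms sum_negf[symmetric] admittance_sym[of _ _ "source \<Gamma>"])
    (simp add: algebra_simps)

text \<open>
  In the sum \<open>\<Sum>x. cnj (v x) \<Delta>v(x)\<close> only the source survives: \<open>v\<close> vanishes on the ground and is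
  harmonic elsewhere.
\<close>
lemma source_flow_eq_energy:
  assumes net: "finite_network \<Gamma>" and v: "dirichlet_solution \<Gamma> \<mu> v"
  shows "source_flow \<Gamma> \<mu> v =
    (\<Sum>x\<in>vertices \<Gamma>. \<Sum>y\<in>vertices \<Gamma>. of_real ((cmod (v x - v y))\<^sup>2) * admittance \<Gamma> \<mu> x y) / 2"
proof -
  let ?a = "source \<Gamma>"
  have "(\<Sum>x\<in>vertices \<Gamma>. cnj (v x) * laplacian \<Gamma> \<mu> v x) = (\<Sum>x\<in>{?a}. cnj (v x) * laplacian \<Gamma> \<mu> v x)"
    using net v by (intro sum.mono_neutral_right) (auto simp: finite_network_def dirichlet_solution_def)
  moreover have "v ?a = 1"
    using v by (simp add: dirichlet_solution_def)
  ultimately have "source_flow \<Gamma> \<mu> v = - (\<Sum>x\<in>vertices \<Gamma>. cnj (v x) * laplacian \<Gamma> \<mu> v x)"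
    using source_flow_eq_laplacian[of v \<Gamma> \<mu>] by simp
  then show ?thesis
    unfolding sum_cnj_laplacian by (simp only: minus_divide_left[symmetric] minus_minus)
qed

text \<open>
  Dividing by \<open>Im \<mu>\<close> makes the weights positive in both half planes; every edge that joins
  distinct vertices is counted twice, hence the factor 1/2.
\<close>
definition dirichlet_energy :: "'v network \<Rightarrow> complex \<Rightarrow> ('v \<Rightarrow> complex) \<Rightarrow> real" where
  "dirichlet_energy \<Gamma> \<mu> f =
    (\<Sum>x\<in>vertices \<Gamma>. \<Sum>y\<in>vertices \<Gamma>. (cmod (f x - f y))\<^sup>2 * (Im (admittance \<Gamma> \<mu> x y) / Im \<mu>)) / 2"

lemma dirichlet_energy_eq_Im:
  "dirichlet_energy \<Gamma> \<mu> f =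
    Im ((\<Sum>x\<in>vertices \<Gamma>. \<Sum>y\<in>vertices \<Gamma>. of_real ((cmod (f x - f y))\<^sup>2) * admittance \<Gamma> \<mu> x y) / 2) / Im \<mu>"
  by (simp add: dirichlet_energy_def sum_divide_distrib mult.commute del: of_real_power)

lemma potential_eq_zero_if_dirichlet_energy_eq_zero:
  assumes net: "finite_network \<Gamma>"
    and pos: "\<And>x y. adjacent \<Gamma> x y \<Longrightarrow> Im (admittance \<Gamma> \<mu> x y) / Im \<mu> > 0"
    and zero: "dirichlet_energy \<Gamma> \<mu> f = 0" and a: "f (source \<Gamma>) = 0" and x: "x \<in> vertices \<Gamma>"
  shows "f x = 0"
proof -
  let ?V = "vertices \<Gamma>" and ?k = "\<lambda>x y. Im (admittance \<Gamma> \<mu> x y) / Im \<mu>"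
  have fin: "finite ?V" using net by (simp add: finite_network_def)
  have nn: "?k x y \<ge> 0" for x y
    using pos[of x y] by (cases "adjacent \<Gamma> x y") (auto simp: admittance_def)
  have e_nn: "(cmod (f x - f y))\<^sup>2 * ?k x y \<ge> 0" for x y
    by (intro mult_nonneg_nonneg nn) simp
  have terms: "(cmod (f x - f y))\<^sup>2 * ?k x y = 0" if "x \<in> ?V" "y \<in> ?V" for x y
  proof -
    have "(\<Sum>x\<in>?V. \<Sum>y\<in>?V. (cmod (f x - f y))\<^sup>2 * ?k x y) = 0"
      using zero by (simp add: dirichlet_energy_def)
    then have "(\<Sum>y\<in>?V. (cmod (f x - f y))\<^sup>2 * ?k x y) = 0"
      using that(1) fin e_nn by (subst (asm) sum_nonneg_eq_0_iff) (auto intro!: sum_nonneg)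
    then show ?thesis
      using that(2) fin e_nn by (subst (asm) sum_nonneg_eq_0_iff) auto
  qed
  have edge: "f x = f y" if adj: "adjacent \<Gamma> x y" for x y
  proof -
    have "x \<in> ?V" "y \<in> ?V"
      using net adj by (auto simp: finite_network_def adjacent_def)
    from terms[OF this] pos[OF adj] show ?thesis by force
  qed
  have "(adjacent \<Gamma>)\<^sup>*\<^sup>* (source \<Gamma>) x"
    using net x by (simp add: finite_network_def)
  then have "f x = f (source \<Gamma>)"
    by (induction rule: rtranclp_induct) (auto dest: edge)
  with a show ?thesis by simp
qed

text \<open>
  The unknowns are the values at the interior vertices, and the matrix is the Laplacian restricted to
  them. Its form at \<open>f\<close> is that of the Laplacian at the extension of \<open>f\<close> by zero, so a zero of the
  form has vanishing Dirichlet energy.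
\<close>
lemma holomorphic_dirichlet_solution:
  fixes \<Gamma> :: "'v network"
  assumes net: "finite_network \<Gamma>"
    and hol: "\<And>x y. (\<lambda>\<mu>. admittance \<Gamma> \<mu> x y) holomorphic_on \<Omega>"
    and pos: "\<And>\<mu> x y. \<mu> \<in> \<Omega> \<Longrightarrow> adjacent \<Gamma> x y \<Longrightarrow> Im (admittance \<Gamma> \<mu> x y) / Im \<mu> > 0"
  shows "\<exists>v. (\<forall>x. (\<lambda>\<mu>. v \<mu> x) holomorphic_on \<Omega>) \<and> (\<forall>\<mu>\<in>\<Omega>. dirichlet_solution \<Gamma> \<mu> (v \<mu>))"
proof -
  let ?V = "vertices \<Gamma>" and ?a = "source \<Gamma>" and ?r = "admittance \<Gamma>"
  let ?I = "?V - (ground \<Gamma> \<union> {?a})"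
  have fin: "finite ?V" and a: "?a \<in> ?V" "?a \<notin> ground \<Gamma>"
    using net by (auto simp: finite_network_def)
  define M where "M \<mu> x y = ?r \<mu> x y - (if y = x then \<Sum>z\<in>?V. ?r \<mu> x z else 0)" for \<mu> x y
  have lap: "laplacian \<Gamma> \<mu> f x = (\<Sum>y\<in>?I. M \<mu> x y * f y) + ?r \<mu> x ?a * f ?a"
    if x: "x \<in> ?I" and f: "\<And>y. y \<in> ground \<Gamma> \<Longrightarrow> f y = 0" for \<mu> f x
  proof -
    have "(\<Sum>y\<in>?V. ?r \<mu> x y * f y) = (\<Sum>y\<in>insert ?a ?I. ?r \<mu> x y * f y)"
      using fin a f by (intro sum.mono_neutral_right) auto
    also have "\<dots> = ?r \<mu> x ?a * f ?a + (\<Sum>y\<in>?I. ?r \<mu> x y * f y)"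
      using fin by simp
    finally have 1: "(\<Sum>y\<in>?V. ?r \<mu> x y * f y) = ?r \<mu> x ?a * f ?a + (\<Sum>y\<in>?I. ?r \<mu> x y * f y)" .
    have "(\<Sum>y\<in>?I. M \<mu> x y * f y) = (\<Sum>y\<in>?I. ?r \<mu> x y * f y)
        - (\<Sum>y\<in>?I. if y = x then (\<Sum>z\<in>?V. ?r \<mu> x z) * f x else 0)"
      unfolding sum_subtractf[symmetric] by (intro sum.cong refl) (simp add: M_def algebra_simps)
    also have "(\<Sum>y\<in>?I. if y = x then (\<Sum>z\<in>?V. ?r \<mu> x z) * f x else 0) = (\<Sum>z\<in>?V. ?r \<mu> x z) * f x"
      using x fin by (subst sum.delta) auto
    finally have 2: "(\<Sum>y\<in>?I. M \<mu> x y * f y) = (\<Sum>y\<in>?I. ?r \<mu> x y * f y) - (\<Sum>z\<in>?V. ?r \<mu> x z) * f x" .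
    have "laplacian \<Gamma> \<mu> f x = (\<Sum>y\<in>?V. ?r \<mu> x y * f y) - (\<Sum>z\<in>?V. ?r \<mu> x z) * f x"
      by (simp add: laplacian_def algebra_simps sum_subtractf sum_distrib_left)
    then show ?thesis using 1 2 by simp
  qed
  have "\<exists>u. (\<forall>x\<in>?I. (\<lambda>\<mu>. u \<mu> x) holomorphic_on \<Omega>) \<and>
    (\<forall>\<mu>\<in>\<Omega>. \<forall>x\<in>?I. (\<Sum>y\<in>?I. M \<mu> x y * u \<mu> y) = - ?r \<mu> x ?a)"
  proof (rule holomorphic_solution_of_anisotropic_system)
    show "finite ?I" using fin by simp
    show "(\<lambda>\<mu>. M \<mu> x y) holomorphic_on \<Omega>" for x y
      unfolding M_def by (cases "y = x") (auto intro!: holomorphic_intros hol)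
    show "(\<lambda>\<mu>. - ?r \<mu> x ?a) holomorphic_on \<Omega>" for x
      by (intro holomorphic_intros hol)
    show "\<forall>x\<in>?I. f x = 0"
      if \<mu>: "\<mu> \<in> \<Omega>" and f: "(\<Sum>x\<in>?I. cnj (f x) * (\<Sum>y\<in>?I. M \<mu> x y * f y)) = 0" for \<mu> f
    proof -
      let ?g = "\<lambda>x. if x \<in> ?I then f x else 0"
      have "(\<Sum>x\<in>?V. cnj (?g x) * laplacian \<Gamma> \<mu> ?g x) = (\<Sum>x\<in>?I. cnj (?g x) * laplacian \<Gamma> \<mu> ?g x)"
        using fin by (intro sum.mono_neutral_right) auto
      also have "\<dots> = (\<Sum>x\<in>?I. cnj (f x) * (\<Sum>y\<in>?I. M \<mu> x y * f y))"
      proof (intro sum.cong refl)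
        fix x assume x: "x \<in> ?I"
        have "laplacian \<Gamma> \<mu> ?g x = (\<Sum>y\<in>?I. M \<mu> x y * ?g y)"
          using lap[OF x, of ?g \<mu>] by simp
        also have "\<dots> = (\<Sum>y\<in>?I. M \<mu> x y * f y)" by (intro sum.cong refl) simp
        finally show "cnj (?g x) * laplacian \<Gamma> \<mu> ?g x = cnj (f x) * (\<Sum>y\<in>?I. M \<mu> x y * f y)"
          using x by simp
      qed
      finally have "(\<Sum>x\<in>?V. cnj (?g x) * laplacian \<Gamma> \<mu> ?g x) = 0" using f by simp
      then have "dirichlet_energy \<Gamma> \<mu> ?g = 0"
        unfolding dirichlet_energy_eq_Im sum_cnj_laplacian by simp
      then have "?g x = 0" if "x \<in> ?V" for x
        using potential_eq_zero_if_dirichlet_energy_eq_zero[OF net pos[OF \<mu>], of ?g x] that by simp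
      then show ?thesis by (metis DiffD1)
    qed
  qed
  then obtain u where uhol: "\<And>x. x \<in> ?I \<Longrightarrow> (\<lambda>\<mu>. u \<mu> x) holomorphic_on \<Omega>"
    and u: "\<And>\<mu> x. \<mu> \<in> \<Omega> \<Longrightarrow> x \<in> ?I \<Longrightarrow> (\<Sum>y\<in>?I. M \<mu> x y * u \<mu> y) = - ?r \<mu> x ?a"
    by blast
  define v where "v \<mu> x = (if x \<in> ?I then u \<mu> x else if x = ?a then 1 else 0)" for \<mu> x
  have "(\<lambda>\<mu>. v \<mu> x) holomorphic_on \<Omega>" for x
  proof (cases "x \<in> ?I")
    case True
    then show ?thesis using uhol by (simp add: v_def)
  next
    case False
    then have "(\<lambda>\<mu>. v \<mu> x) = (\<lambda>\<mu>. if x = ?a then 1 else 0)" by (auto simp: v_def)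
    then show ?thesis by simp
  qed
  moreover have "dirichlet_solution \<Gamma> \<mu> (v \<mu>)" if \<mu>: "\<mu> \<in> \<Omega>" for \<mu>
  proof -
    have va: "v \<mu> ?a = 1" and vB: "\<And>y. y \<in> ground \<Gamma> \<Longrightarrow> v \<mu> y = 0"
      using a by (auto simp: v_def)
    have "laplacian \<Gamma> \<mu> (v \<mu>) x = 0" if x: "x \<in> ?I" for x
    proof -
      have "(\<Sum>y\<in>?I. M \<mu> x y * v \<mu> y) = (\<Sum>y\<in>?I. M \<mu> x y * u \<mu> y)"
        by (intro sum.cong refl) (simp add: v_def)
      then show ?thesis using lap[OF x vB] va u[OF \<mu> x] by simp
    qed
    then show ?thesis using va vB by (simp add: dirichlet_solution_def)
  qed
  ultimately show ?thesis by blast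
qed

text \<open>
  The energy dominates its part on the edges at the source and is at most \<open>|P| / |Im \<mu>|\<close>, so
  Cauchy-Schwarz bounds \<open>|P|\<^sup>2\<close> by a multiple of \<open>|P|\<close>. The number \<open>c x\<close> bounds the ratio of \<open>|\<rho>|\<^sup>2\<close>
  to the energy weight of the edge from \<open>x\<close> to the source.
\<close>
lemma norm_source_flow_le:
  assumes net: "finite_network \<Gamma>" and v: "dirichlet_solution \<Gamma> \<mu> v"
    and pos: "\<And>x y. adjacent \<Gamma> x y \<Longrightarrow> Im (admittance \<Gamma> \<mu> x y) / Im \<mu> > 0"
    and c: "\<And>x. adjacent \<Gamma> x (source \<Gamma>) \<Longrightarrow> c x \<ge> 0 \<and>
      (cmod (admittance \<Gamma> \<mu> x (source \<Gamma>)))\<^sup>2 \<le> Im (admittance \<Gamma> \<mu> x (source \<Gamma>)) / Im \<mu> * c x"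
  shows "cmod (source_flow \<Gamma> \<mu> v) \<le> (\<Sum>x \<in> {x \<in> vertices \<Gamma>. adjacent \<Gamma> x (source \<Gamma>)}. c x) / \<bar>Im \<mu>\<bar>"
proof -
  let ?V = "vertices \<Gamma>" and ?a = "source \<Gamma>" and ?k = "\<lambda>x y. Im (admittance \<Gamma> \<mu> x y) / Im \<mu>"
  let ?N = "{x \<in> ?V. adjacent \<Gamma> x ?a}" and ?P = "source_flow \<Gamma> \<mu> v"
  let ?e = "\<lambda>x y. (cmod (v x - v y))\<^sup>2 * ?k x y"
  have fin: "finite ?V" and a: "?a \<in> ?V" using net by (auto simp: finite_network_def)
  have va: "v ?a = 1" using v by (simp add: dirichlet_solution_def)
  have nn: "?k x y \<ge> 0" for x y
    using pos[of x y] by (cases "adjacent \<Gamma> x y") (auto simp: admittance_def)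
  have e_nn: "?e x y \<ge> 0" for x y
    using nn by (intro mult_nonneg_nonneg) auto
  \<comment> \<open>The double sum in the energy contains every edge from the source to another vertex twice,
    once in the row and once in the column of the source. This compensates its factor 1/2.\<close>
  have row: "(\<Sum>x\<in>?N. ?e x ?a) \<le> dirichlet_energy \<Gamma> \<mu> v"
  proof -
    have N: "(\<Sum>x\<in>?N. ?e x ?a) \<le> (\<Sum>x\<in>?V-{?a}. ?e x ?a)"
    proof -
      have "(\<Sum>x\<in>?N. ?e x ?a) = (\<Sum>x\<in>?N-{?a}. ?e x ?a)"
        using fin by (intro sum.mono_neutral_right) auto
      also have "\<dots> \<le> (\<Sum>x\<in>?V-{?a}. ?e x ?a)"
        using fin e_nn by (intro sum_mono2) auto
      finally show ?thesis .
    qed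
    have "(\<Sum>x\<in>?V. \<Sum>y\<in>?V. ?e x y) = (\<Sum>y\<in>?V. ?e ?a y) + (\<Sum>x\<in>?V-{?a}. \<Sum>y\<in>?V. ?e x y)"
      by (rule sum.remove[OF fin a])
    moreover have "(\<Sum>y\<in>?V. ?e ?a y) \<ge> (\<Sum>x\<in>?V-{?a}. ?e x ?a)"
    proof -
      have "(\<Sum>y\<in>?V. ?e ?a y) = (\<Sum>x\<in>?V. ?e x ?a)"
        by (intro sum.cong refl) (simp add: norm_minus_commute admittance_sym[of _ _ ?a])
      also have "\<dots> \<ge> (\<Sum>x\<in>?V-{?a}. ?e x ?a)"
        using fin e_nn by (intro sum_mono2) auto
      finally show ?thesis .
    qed
    moreover have "(\<Sum>x\<in>?V-{?a}. \<Sum>y\<in>?V. ?e x y) \<ge> (\<Sum>x\<in>?V-{?a}. ?e x ?a)"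
      using fin a e_nn by (intro sum_mono member_le_sum) auto
    ultimately show ?thesis using N unfolding dirichlet_energy_def by linarith
  qed
  have dis: "dirichlet_energy \<Gamma> \<mu> v \<le> cmod ?P / \<bar>Im \<mu>\<bar>"
  proof -
    have "dirichlet_energy \<Gamma> \<mu> v = Im ?P / Im \<mu>"
      unfolding dirichlet_energy_eq_Im source_flow_eq_energy[OF net v] ..
    also have "\<dots> \<le> \<bar>Im ?P\<bar> / \<bar>Im \<mu>\<bar>"
      by (metis abs_divide abs_ge_self)
    also have "\<dots> \<le> cmod ?P / \<bar>Im \<mu>\<bar>"
      by (intro divide_right_mono abs_Im_le_cmod) auto
    finally show ?thesis .
  qed
  have "?P = (\<Sum>x\<in>?N. (1 - v x) * admittance \<Gamma> \<mu> x ?a)"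
    unfolding source_flow_def using fin by (intro sum.mono_neutral_right) (auto simp: admittance_def)
  then have "cmod ?P \<le> (\<Sum>x\<in>?N. cmod ((1 - v x) * admittance \<Gamma> \<mu> x ?a))"
    by (metis norm_sum)
  also have "\<dots> \<le> (\<Sum>x\<in>?N. sqrt (?e x ?a) * sqrt (c x))"
  proof (intro sum_mono)
    fix x assume "x \<in> ?N"
    then have "(cmod (admittance \<Gamma> \<mu> x ?a))\<^sup>2 \<le> ?k x ?a * c x" using c by simp
    then have "(cmod (1 - v x))\<^sup>2 * (cmod (admittance \<Gamma> \<mu> x ?a))\<^sup>2 \<le> (cmod (1 - v x))\<^sup>2 * (?k x ?a * c x)"
      by (intro mult_left_mono) auto
    then have "(cmod ((1 - v x) * admittance \<Gamma> \<mu> x ?a))\<^sup>2 \<le> ?e x ?a * c x"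
      by (simp add: va norm_mult power_mult_distrib norm_minus_commute[of 1] mult.assoc)
    then show "cmod ((1 - v x) * admittance \<Gamma> \<mu> x ?a) \<le> sqrt (?e x ?a) * sqrt (c x)"
      unfolding real_sqrt_mult[symmetric] by (rule real_le_rsqrt)
  qed
  finally have "(cmod ?P)\<^sup>2 \<le> (\<Sum>x\<in>?N. sqrt (?e x ?a) * sqrt (c x))\<^sup>2"
    by (intro power_mono) auto
  also have "\<dots> \<le> (\<Sum>x\<in>?N. (sqrt (?e x ?a))\<^sup>2) * (\<Sum>x\<in>?N. (sqrt (c x))\<^sup>2)"
    by (rule Cauchy_Schwarz_ineq_sum)
  also have "\<dots> = (\<Sum>x\<in>?N. ?e x ?a) * (\<Sum>x\<in>?N. c x)"
    using c e_nn by (intro arg_cong2[of _ _ _ _ "(*)"] sum.cong refl) auto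
  also have "\<dots> \<le> cmod ?P / \<bar>Im \<mu>\<bar> * (\<Sum>x\<in>?N. c x)"
    using row dis c by (intro mult_right_mono sum_nonneg) auto
  finally have sq: "cmod ?P * cmod ?P \<le> cmod ?P * ((\<Sum>x\<in>?N. c x) / \<bar>Im \<mu>\<bar>)"
    by (simp add: power2_eq_square)
  have "(\<Sum>x\<in>?N. c x) / \<bar>Im \<mu>\<bar> \<ge> 0"
    using c by (intro divide_nonneg_nonneg sum_nonneg) auto
  then show ?thesis
    using mult_left_le_imp_le[OF sq] by (cases "?P = 0") simp_all
qed

section \<open>The admittance of an edge\<close>

text \<open>
  From \<open>Im (1/z) = - Im z / |z|\<^sup>2\<close>. The formula serves twice: it shows that the weights are positive
  when \<open>L |\<mu>|\<^sup>2 < D\<close>, and it is the comparison of \<open>|\<rho>|\<^sup>2\<close> with the weight that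
  \<open>norm_source_flow_le\<close> asks for.
\<close>
lemma Im_admittance:
  assumes "adjacent \<Gamma> x y" "Im \<mu> \<noteq> 0"
  shows "Im (admittance \<Gamma> \<mu> x y) / Im \<mu> =
    (elastance \<Gamma> (Upair x y) - inductance \<Gamma> (Upair x y) * (cmod \<mu>)\<^sup>2) / (cmod \<mu>)\<^sup>2
      * (cmod (admittance \<Gamma> \<mu> x y))\<^sup>2"
proof -
  let ?z = "impedance \<Gamma> \<mu> (Upair x y)"
  have nz: "(cmod \<mu>)\<^sup>2 \<noteq> 0" using assms(2) by auto
  have inv: "Im (1 / w) = - Im w * (cmod (1 / w))\<^sup>2" for w
    by (cases "w = 0") (simp_all add: Im_divide cmod_power2[symmetric] norm_divide power_divide)
  have "Im ?z = inductance \<Gamma> (Upair x y) * Im \<mu> - elastance \<Gamma> (Upair x y) * Im \<mu> / (cmod \<mu>)\<^sup>2"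
    by (simp add: impedance_def Im_divide cmod_power2)
  then have "- Im ?z / Im \<mu> =
      (elastance \<Gamma> (Upair x y) - inductance \<Gamma> (Upair x y) * (cmod \<mu>)\<^sup>2) / (cmod \<mu>)\<^sup>2"
    using assms(2) nz by (simp add: field_simps)
  moreover have "Im (admittance \<Gamma> \<mu> x y) / Im \<mu> = - Im ?z / Im \<mu> * (cmod (admittance \<Gamma> \<mu> x y))\<^sup>2"
    using assms(1) inv[of ?z] by (simp add: admittance_def)
  ultimately show ?thesis by simp
qed

lemma impedance_nonzero:
  assumes "Im \<mu> \<noteq> 0" "inductance \<Gamma> e * (cmod \<mu>)\<^sup>2 < elastance \<Gamma> e"
  shows "impedance \<Gamma> \<mu> e \<noteq> 0"
proof
  assume "impedance \<Gamma> \<mu> e = 0"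
  moreover have "Im (impedance \<Gamma> \<mu> e)
      = Im \<mu> * (inductance \<Gamma> e * (cmod \<mu>)\<^sup>2 - elastance \<Gamma> e) / (cmod \<mu>)\<^sup>2"
    using assms(1) by (simp add: impedance_def Im_divide cmod_power2 field_simps)
  ultimately show False using assms by auto
qed

section \<open>Holomorphy and growth of the effective admittance\<close>

theorem theorem19:
  fixes \<Gamma> :: "'v network"
    and S\<^sub>D S\<^sub>D' S\<^sub>R C' :: real
    and \<Omega> :: "complex set"
  assumes "finite_network \<Gamma>"
    and "\<forall>e\<in>edges \<Gamma>. inductance \<Gamma> e > 0"
    and "S\<^sub>D = (SUP e\<in>edges \<Gamma>. elastance \<Gamma> e / inductance \<Gamma> e)"
    and "S\<^sub>D' = (INF e\<in>edges \<Gamma>. elastance \<Gamma> e / inductance \<Gamma> e)"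
    and "S\<^sub>R = (SUP e\<in>edges \<Gamma>. resistance \<Gamma> e / inductance \<Gamma> e)"
    and "C' = (\<Sum>x \<in> {x \<in> vertices \<Gamma>. adjacent \<Gamma> x (source \<Gamma>)}.
                 1 / inductance \<Gamma> (Upair x (source \<Gamma>)))"
    and "\<Omega> = {\<mu>. Im \<mu> \<noteq> 0 \<and> (cmod \<mu>)\<^sup>2 < S\<^sub>D'}"
  shows "\<Omega> \<subseteq> admissible \<Gamma> \<and>
    (\<exists>P. P holomorphic_on \<Omega> \<and>
      (\<forall>\<mu>\<in>\<Omega>. effective_admittance \<Gamma> \<mu> = Some (P \<mu>) \<and>
        cmod (P \<mu>) \<le> C' * ((cmod \<mu>)\<^sup>2 + S\<^sub>R * cmod \<mu> + S\<^sub>D)\<^sup>2 * (cmod \<mu>) ^ 4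
                      / ((S\<^sub>D' - (cmod \<mu>)\<^sup>2) ^ 3 * \<bar>Im \<mu>\<bar> ^ 3)))"
proof -
  note net = assms(1) and L = assms(2) and \<Omega> = assms(7)
  let ?a = "source \<Gamma>" and ?E = "edges \<Gamma>"
  have fin: "finite (vertices \<Gamma>)" using net by (simp add: finite_network_def)
  have finE: "finite ?E"
  proof (rule finite_subset)
    show "?E \<subseteq> (\<lambda>(x, y). Upair x y) ` (vertices \<Gamma> \<times> vertices \<Gamma>)"
    proof
      fix e assume e: "e \<in> ?E"
      obtain x y where xy: "e = Upair x y" by (cases e)
      have "x \<in> vertices \<Gamma>" "y \<in> vertices \<Gamma>"
        using net e by (auto simp: finite_network_def xy)
      then show "e \<in> (\<lambda>(x, y). Upair x y) ` (vertices \<Gamma> \<times> vertices \<Gamma>)"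
        using xy by auto
    qed
    show "finite ((\<lambda>(x, y). Upair x y) ` (vertices \<Gamma> \<times> vertices \<Gamma>))" using fin by simp
  qed
  \<comment> \<open>An edge must exist for the supremum and infimum to be comparable: the source is connected
    to the ground, so it has a neighbour.\<close>
  obtain e\<^sub>0 where e\<^sub>0: "e\<^sub>0 \<in> ?E"
  proof -
    have "ground \<Gamma> \<noteq> {}" "ground \<Gamma> \<subseteq> vertices \<Gamma>" "?a \<notin> ground \<Gamma>"
      using net by (auto simp: finite_network_def)
    then obtain g where "g \<in> vertices \<Gamma>" "g \<noteq> ?a" by blast
    then have "(adjacent \<Gamma>)\<^sup>*\<^sup>* ?a g" "?a \<noteq> g" using net by (auto simp: finite_network_def)
    then obtain z where "adjacent \<Gamma> ?a z" by (auto elim: converse_rtranclpE)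
    then show ?thesis using that by (auto simp: adjacent_def)
  qed
  have nonneg: "resistance \<Gamma> e \<ge> 0" "elastance \<Gamma> e \<ge> 0" if "e \<in> ?E" for e
    using net that by (auto simp: finite_network_def)
  have inf: "S\<^sub>D' \<le> elastance \<Gamma> e / inductance \<Gamma> e" if "e \<in> ?E" for e
    unfolding assms(4) using finE that by (intro cINF_lower) auto
  have "elastance \<Gamma> e\<^sub>0 / inductance \<Gamma> e\<^sub>0 \<le> S\<^sub>D"
    unfolding assms(3) using finE e\<^sub>0 by (intro cSUP_upper) auto
  then have S_le: "S\<^sub>D' \<le> S\<^sub>D" using inf[OF e\<^sub>0] by simp
  have "resistance \<Gamma> e\<^sub>0 / inductance \<Gamma> e\<^sub>0 \<le> S\<^sub>R"
    unfolding assms(5) using finE e\<^sub>0 by (intro cSUP_upper) auto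
  moreover have "0 \<le> resistance \<Gamma> e\<^sub>0 / inductance \<Gamma> e\<^sub>0"
    using nonneg[OF e\<^sub>0] L e\<^sub>0 by (intro divide_nonneg_pos) auto
  ultimately have SR: "S\<^sub>R \<ge> 0" by simp

  have gap: "elastance \<Gamma> e - inductance \<Gamma> e * (cmod \<mu>)\<^sup>2 \<ge> inductance \<Gamma> e * (S\<^sub>D' - (cmod \<mu>)\<^sup>2)"
    if "e \<in> ?E" for e \<mu>
    using inf[OF that] L that by (simp add: field_simps)
  have gap': "inductance \<Gamma> e * (cmod \<mu>)\<^sup>2 < elastance \<Gamma> e" if "e \<in> ?E" "\<mu> \<in> \<Omega>" for e \<mu>
  proof -
    have "inductance \<Gamma> e * (S\<^sub>D' - (cmod \<mu>)\<^sup>2) > 0"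
      using that L by (intro mult_pos_pos) (auto simp: \<Omega>)
    then show ?thesis using gap[OF that(1), of \<mu>] by linarith
  qed
  have Im_nz: "Im \<mu> \<noteq> 0" "\<mu> \<noteq> 0" if "\<mu> \<in> \<Omega>" for \<mu> using that by (auto simp: \<Omega>)
  have z_nz: "impedance \<Gamma> \<mu> e \<noteq> 0" if "e \<in> ?E" "\<mu> \<in> \<Omega>" for e \<mu>
    by (rule impedance_nonzero[OF Im_nz(1)[OF that(2)] gap'[OF that]])
  have adm: "\<Omega> \<subseteq> admissible \<Gamma>"
  proof
    fix \<mu> assume \<mu>: "\<mu> \<in> \<Omega>"
    have "of_real (inductance \<Gamma> e) * \<mu>\<^sup>2 + of_real (resistance \<Gamma> e) * \<mu> + of_real (elastance \<Gamma> e)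
        = \<mu> * impedance \<Gamma> \<mu> e" for e
      using Im_nz(2)[OF \<mu>] by (simp add: impedance_def field_simps power2_eq_square)
    then show "\<mu> \<in> admissible \<Gamma>"
      using z_nz[OF _ \<mu>] Im_nz(2)[OF \<mu>] by (simp add: admissible_def)
  qed
  have hol: "(\<lambda>\<mu>. admittance \<Gamma> \<mu> x y) holomorphic_on \<Omega>" for x y
  proof (cases "adjacent \<Gamma> x y")
    case True
    then have e: "Upair x y \<in> ?E" by (simp add: adjacent_def)
    have "(\<lambda>\<mu>. 1 / impedance \<Gamma> \<mu> (Upair x y)) holomorphic_on \<Omega>"
      using z_nz[OF e] Im_nz(2) unfolding impedance_def by (intro holomorphic_intros) auto
    then show ?thesis using True by (simp add: admittance_def)
  next
    case False
    then show ?thesis by (simp add: admittance_def)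
  qed
  have pos: "Im (admittance \<Gamma> \<mu> x y) / Im \<mu> > 0" if \<mu>: "\<mu> \<in> \<Omega>" and adj: "adjacent \<Gamma> x y" for \<mu> x y
  proof -
    have e: "Upair x y \<in> ?E" using adj by (simp add: adjacent_def)
    show ?thesis
      unfolding Im_admittance[OF adj Im_nz(1)[OF \<mu>]]
      using gap'[OF e \<mu>] z_nz[OF e \<mu>] Im_nz(2)[OF \<mu>] adj
      by (intro mult_pos_pos divide_pos_pos) (auto simp: admittance_def)
  qed
  obtain v where vhol: "\<And>x. (\<lambda>\<mu>. v \<mu> x) holomorphic_on \<Omega>"
    and v: "\<And>\<mu>. \<mu> \<in> \<Omega> \<Longrightarrow> dirichlet_solution \<Gamma> \<mu> (v \<mu>)"
    using holomorphic_dirichlet_solution[OF net hol pos] by blast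
  let ?P = "\<lambda>\<mu>. source_flow \<Gamma> \<mu> (v \<mu>)"
  have "?P holomorphic_on \<Omega>"
    unfolding source_flow_def by (intro holomorphic_intros hol vhol)
  moreover have "cmod (?P \<mu>) \<le> C' * ((cmod \<mu>)\<^sup>2 + S\<^sub>R * cmod \<mu> + S\<^sub>D)\<^sup>2 * (cmod \<mu>) ^ 4
                      / ((S\<^sub>D' - (cmod \<mu>)\<^sup>2) ^ 3 * \<bar>Im \<mu>\<bar> ^ 3)" if \<mu>: "\<mu> \<in> \<Omega>" for \<mu>
  proof -
    define m where "m = cmod \<mu>"
    define i where "i = \<bar>Im \<mu>\<bar>"
    define d where "d = S\<^sub>D' - m\<^sup>2"
    define q where "q = m\<^sup>2 + S\<^sub>R * m + S\<^sub>D"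
    have i: "i > 0" "i \<le> m" using Im_nz[OF \<mu>] abs_Im_le_cmod by (auto simp: i_def m_def)
    have d: "d > 0" using \<mu> by (auto simp: \<Omega> d_def m_def)
    have "0 \<le> S\<^sub>R * m" using SR i by simp
    then have dq: "d \<le> q" using S_le zero_le_power2[of m] unfolding d_def q_def by linarith
    have C': "C' \<ge> 0"
      unfolding assms(6) using L by (intro sum_nonneg) (auto simp: adjacent_def less_imp_le)
    have "cmod (?P \<mu>) \<le> (\<Sum>x \<in> {x \<in> vertices \<Gamma>. adjacent \<Gamma> x ?a}.
        m\<^sup>2 / d * (1 / inductance \<Gamma> (Upair x ?a))) / \<bar>Im \<mu>\<bar>"
    proof (rule norm_source_flow_le[OF net v[OF \<mu>] pos[OF \<mu>]])
      fix x assume adj: "adjacent \<Gamma> x ?a"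
      let ?e = "Upair x ?a"
      have e: "?e \<in> ?E" using adj by (simp add: adjacent_def)
      have Lp: "inductance \<Gamma> ?e > 0" using L e by blast
      let ?g = "(elastance \<Gamma> ?e - inductance \<Gamma> ?e * m\<^sup>2) / m\<^sup>2" and ?c = "m\<^sup>2 / d * (1 / inductance \<Gamma> ?e)"
      have c: "?c \<ge> 0" using d Lp by simp
      have "1 = inductance \<Gamma> ?e * d / m\<^sup>2 * ?c"
        using d Lp i by simp
      also have "\<dots> \<le> ?g * ?c"
        using gap[OF e, of \<mu>] c by (intro mult_right_mono divide_right_mono) (auto simp: d_def m_def)
      finally have "1 * (cmod (admittance \<Gamma> \<mu> x ?a))\<^sup>2 \<le> ?g * ?c * (cmod (admittance \<Gamma> \<mu> x ?a))\<^sup>2"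
        by (rule mult_right_mono) simp
      then show "?c \<ge> 0 \<and> (cmod (admittance \<Gamma> \<mu> x ?a))\<^sup>2 \<le> Im (admittance \<Gamma> \<mu> x ?a) / Im \<mu> * ?c"
        using c unfolding Im_admittance[OF adj Im_nz(1)[OF \<mu>]] m_def by (simp only: mult_1_left mult_ac simp_thms)
    qed
    also have "\<dots> = C' * (m\<^sup>2 / (d * i))"
      unfolding assms(6) sum_distrib_left[symmetric] by (simp add: i_def)
    \<comment> \<open>The estimate so far is sharper than the claim. The extra factor is at least 1, since
      \<open>S\<^sub>D' - m\<^sup>2 \<le> S\<^sub>D\<close> and \<open>|Im \<mu>| \<le> m\<close>.\<close>
    also have "\<dots> \<le> C' * (m\<^sup>2 / (d * i) * ((q * m) / (d * i))\<^sup>2)"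
    proof -
      have "d * i \<le> q * m" using d dq i by (intro mult_mono) auto
      then have "1 \<le> ((q * m) / (d * i))\<^sup>2" using d i by (intro one_le_power) simp
      then have "m\<^sup>2 / (d * i) * 1 \<le> m\<^sup>2 / (d * i) * ((q * m) / (d * i))\<^sup>2"
        using d i by (intro mult_left_mono) auto
      then show ?thesis using C' by (intro mult_left_mono) auto
    qed
    also have "\<dots> = C' * q\<^sup>2 * m ^ 4 / (d ^ 3 * i ^ 3)"
      by (simp add: power_divide power_mult_distrib power2_eq_square power3_eq_cube power4_eq_xxxx
          mult_ac)
    finally show ?thesis by (simp add: m_def i_def d_def q_def)
  qed
  ultimately show ?thesis
    using adm effective_admittance_eq[OF net v] by blast
qed

end
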